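(* Let $A:\mathbb{R}^n\to\mathbb{R}^{n_c\times m}$ and $b:\mathbb{R}^n\to\mathbb{R}^{n_c}$ be continuous, and suppose that for every $x\in\mathbb{R}^n$ the feasible region $\mathcal S(x)=\{y\in\mathbb{R}^m\mid A(x)y\le b(x)\}$ is a non-empty (bounded) polytope. Let $f_\theta,w_\phi:\mathbb{R}^n\to\mathbb{R}^m$ be given, and let $\mathcal P^*(x)$ be the corresponding output of CAffNet-Lite (defined in the context). Then for any $x\in\mathbb{R}^n$ the output $\mathcal P^*(x)$ satisfies the state-dependent affine constraints, i.e. $A(x)\mathcal P^*(x)\le b(x)$.
   Context: Vector inequalities are componentwise. $M^\dagger$ is the Moore–Penrose pseudoinverse of $M$. CAffNet-Lite. Let $a_j(x)^\top$ be the rows of $A(x)$ and $b_j(x)$ the entries of $b(x)$. Let $\Gamma$ be the set of all index sequences $\gamma=(j_1,\dots,j_k)$ with $k\in\{1,\min(n_c,m)\}$ and $1\le j_1<\dots<j_k\le n_c$. For $\gamma\in\Gamma$, let $A_\gamma(x)$ and $b_\gamma(x)$ be the submatrix of $A(x)$ and the subvector of $b(x)$ with rows indexed by $\gamma$ (no rank condition is imposed). Given $f_\theta,w_\phi:\mathbb{R}^n\to\mathbb{R}^m$ (neural networks: $f_\theta$ is the unconstrained output and $w_\phi$ the null-space component), define $$\mathcal P_\gamma(x)=f_\theta(x)-A_\gamma^\dagger(x)\big(A_\gamma(x)f_\theta(x)-b_\gamma(x)\big)+\big(I-A_\gamma^\dagger(x)A_\gamma(x)\big)w_\phi(x),$$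 $$\mathcal S_{\mathcal P}(x)=\{\mathcal P_\gamma(x)\mid \gamma\in\Gamma,\ A(x)\mathcal P_\gamma(x)\le b(x)\}.$$ Fix a $p$-norm $\|\cdot\|_p$ on $\mathbb{R}^m$. The output is $\mathcal P^*(x)=f_\theta(x)$ if $f_\theta(x)\in\mathcal S(x)$, and otherwise $\mathcal P^*(x)$ is an element of $\arg\min_{y\in\mathcal S_{\mathcal P}(x)}\|y-f_\theta(x)\|_p$, with ties broken arbitrarily. *)

theory Defs
  imports "HOL-Analysis.Analysis"
begin

definition feasible :: "real^'m^'c \<Rightarrow> real^'c \<Rightarrow> (real^'m) set" where
  "feasible A b = {y. A *v y \<le> b}"

(* Moore-Penrose pseudoinverse of a real matrix: the unique solution of the four Penrose
   equations. *)
definition pinv :: "real^'m^'k \<Rightarrow> real^'k^'m" where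
  "pinv M = (THE X. M ** X ** M = M \<and> X ** M ** X = X \<and>
     transpose (M ** X) = M ** X \<and> transpose (X ** M) = X ** M)"

(* An increasing index sequence of length k over the row indices is a strictly increasing map
   from a linearly ordered type with k elements. The two admissible lengths are 1, for which
   the type 1 is used, and min n_c m, for which the following type is used
   (n_c = CARD('c), m = CARD('m)). *)
typedef (overloaded) ('c::finite, 'm::finite) min_index = "{..<min CARD('c) CARD('m)}"
  by (rule exI[of _ 0]) simp

instantiation min_index :: (finite, finite) linorder
begin

definition less_eq_min_index :: "('a, 'b) min_index \<Rightarrow> ('a, 'b) min_index \<Rightarrow> bool" where
  "i \<le> j \<longleftrightarrow> Rep_min_index i \<le> Rep_min_index j"

definition less_min_index :: "('a, 'b) min_index \<Rightarrow> ('a, 'b) min_index \<Rightarrow> bool" where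
  "i < j \<longleftrightarrow> Rep_min_index i < Rep_min_index j"

instance
  by standard (auto simp: less_eq_min_index_def less_min_index_def Rep_min_index_inject)

end

instance min_index :: (finite, finite) finite
proof
  show "finite (UNIV :: ('a, 'b) min_index set)"
    unfolding type_definition.univ[OF type_definition_min_index]
    by simp
qed

lemma card_min_index: "CARD(('c::finite, 'm::finite) min_index) = min CARD('c) CARD('m)"
  by (simp add: type_definition.card[OF type_definition_min_index])

(* Selection of the rows (entries) listed by an index sequence. It gives both the submatrix
   of a matrix, which is a vector of rows, and the subvector of a vector. *)
definition select :: "'a^'c \<Rightarrow> ('k \<Rightarrow> 'c) \<Rightarrow> 'a^'k" where
  "select v \<gamma> = (\<chi> i. v $ \<gamma> i)"

definition candidate ::
  "real^'m^'c \<Rightarrow> real^'c \<Rightarrow> real^'m \<Rightarrow> real^'m \<Rightarrow> ('k::finite \<Rightarrow> 'c) \<Rightarrow> real^'m" where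
  "candidate A b f w \<gamma> =
     f - pinv (select A \<gamma>) *v (select A \<gamma> *v f - select b \<gamma>)
       + (mat 1 - pinv (select A \<gamma>) ** select A \<gamma>) *v w"

definition candidates ::
  "real^'m^'c::{finite, linorder} \<Rightarrow> real^'c::{finite, linorder} \<Rightarrow> real^'m \<Rightarrow> real^'m \<Rightarrow>
   (real^'m) set" where
  "candidates A b f w =
     {candidate A b f w \<gamma> | \<gamma> :: 1 \<Rightarrow> 'c. strict_mono \<gamma>} \<union>
     {candidate A b f w \<gamma> | \<gamma> :: ('c, 'm) min_index \<Rightarrow> 'c. strict_mono \<gamma>}"

definition feasible_candidates ::
  "real^'m^'c::{finite, linorder} \<Rightarrow> real^'c::{finite, linorder} \<Rightarrow> real^'m \<Rightarrow> real^'m \<Rightarrow>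
   (real^'m) set" where
  "feasible_candidates A b f w = {y \<in> candidates A b f w. A *v y \<le> b}"

definition p_norm :: "ereal \<Rightarrow> real^'m \<Rightarrow> real" where
  "p_norm p v =
     (if p = \<infinity> then infnorm v
      else (\<Sum>i\<in>UNIV. \<bar>v $ i\<bar> powr real_of_ereal p) powr (1 / real_of_ereal p))"

(* The tie-breaking rule picks the output among the minimizers and may depend on the input x.
   It is only constrained on non-empty sets: if there were no minimizer, the output would be
   the unspecified value of the rule at the empty set. *)
definition tie_breaking :: "('x \<Rightarrow> 'y set \<Rightarrow> 'y) \<Rightarrow> bool" where
  "tie_breaking pick \<longleftrightarrow> (\<forall>x T. T \<noteq> {} \<longrightarrow> pick x T \<in> T)"

definition caffnet_lite ::
  "ereal \<Rightarrow> (real^'n \<Rightarrow> (real^'m) set \<Rightarrow> real^'m) \<Rightarrow>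
   (real^'n \<Rightarrow> real^'m^'c::{finite, linorder}) \<Rightarrow>
   (real^'n \<Rightarrow> real^'c::{finite, linorder}) \<Rightarrow>
   (real^'n \<Rightarrow> real^'m) \<Rightarrow> (real^'n \<Rightarrow> real^'m) \<Rightarrow> real^'n \<Rightarrow> real^'m" where
  "caffnet_lite p pick A b f w x =
     (if f x \<in> feasible (A x) (b x) then f x
      else pick x {y. is_arg_min (\<lambda>y. p_norm p (y - f x))
                        (\<lambda>y. y \<in> feasible_candidates (A x) (b x) (f x) (w x)) y})"

end

theory Submission
  imports Defs
begin

text \<open>Whenever \<open>f x\<close> is infeasible, some candidate is feasible, namely a vertex \<open>v\<close> of the polytope.
  The rows active at \<open>v\<close> span the whole space, so \<open>m\<close> of them form a basis. In particular
  \<open>min n\<^sub>c m = m\<close>, the selected submatrix is invertible, its pseudoinverse is its inverse, and the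
  candidate of this index sequence is \<open>v\<close>, whatever \<open>f\<close> and \<open>w\<close> are.\<close>

text \<open>Otherwise some nonzero \<open>d\<close> is orthogonal to every active row. Moving from
  \<open>v\<close> by a small multiple of \<open>d\<close> in either direction keeps active
  constraints tight and slack ones satisfied, so \<open>v\<close> is interior to a feasible
  segment.\<close>

lemma extreme_point_active_rows_span:
  fixes A :: "real^'m^'c" and b :: "real^'c" and v :: "real^'m"
  assumes v: "v extreme_point_of feasible A b"
  shows "span ((\<lambda>i. A $ i) ` {i. (A *v v) $ i = b $ i}) = UNIV" (is "span ?R = UNIV")
proof (rule ccontr)
  assume "span ?R \<noteq> UNIV"
  then obtain d where d: "d \<noteq> 0" "\<And>y. y \<in> span ?R \<Longrightarrow> orthogonal d y"
    using orthogonal_to_subspace_exists_gen[of ?R UNIV] by (auto simp: psubset_eq)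
  have vf: "(A *v v) $ i \<le> b $ i" for i
    using v by (auto simp: extreme_point_of_def feasible_def less_eq_vec_def)
  have act: "(A *v d) $ i = 0" if "(A *v v) $ i = b $ i" for i
    using d(2)[of "A $ i"] that
    by (auto simp: orthogonal_def matrix_vector_mul_component inner_commute intro!: span_base)
  have "\<exists>e>0. \<forall>t. \<bar>t\<bar> \<le> e \<longrightarrow> (A *v v) $ i + t * (A *v d) $ i \<le> b $ i" for i
  proof (cases "(A *v v) $ i = b $ i")
    case True
    then show ?thesis using act by (auto intro!: exI[of _ 1])
  next
    case False
    define s where "s = b $ i - (A *v v) $ i"
    \<comment> \<open>Adding 1 keeps the divisor of \<open>s / a\<close> positive even when
      \<open>d\<close> leaves this constraint unchanged.\<close>
    define a where "a = \<bar>(A *v d) $ i\<bar> + 1"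
    have s: "s > 0" and a: "a > 0" using vf[of i] False by (auto simp: s_def a_def)
    have "t * (A *v d) $ i \<le> s" if "\<bar>t\<bar> \<le> s / a" for t
    proof -
      have "t * (A *v d) $ i \<le> \<bar>t\<bar> * a"
        by (rule order_trans[OF abs_ge_self]) (auto simp: abs_mult a_def mult_left_mono)
      also have "\<dots> \<le> s" using that a by (simp add: field_simps)
      finally show ?thesis .
    qed
    then show ?thesis using s a by (intro exI[of _ "s / a"]) (force simp: s_def)
  qed
  then obtain e where e: "\<And>i. e i > 0"
    "\<And>i t. \<bar>t\<bar> \<le> e i \<Longrightarrow> (A *v v) $ i + t * (A *v d) $ i \<le> b $ i"
    by metis
  \<comment> \<open>There are finitely many constraints, so the least of their step bounds is still
    positive and serves all of them.\<close>
  define \<epsilon> where "\<epsilon> = Min (range e)"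
  have \<epsilon>: "\<epsilon> > 0" "\<And>i. \<epsilon> \<le> e i" using e(1) by (auto simp: \<epsilon>_def)
  have feas: "v + t *\<^sub>R d \<in> feasible A b" if "\<bar>t\<bar> \<le> \<epsilon>" for t
    using e(2)[OF order_trans[OF that \<epsilon>(2)]]
    by (simp add: feasible_def less_eq_vec_def matrix_vector_right_distrib
        matrix_vector_mult_scaleR)
  have "v = midpoint (v + (-\<epsilon>) *\<^sub>R d) (v + \<epsilon> *\<^sub>R d)"
    by (simp add: midpoint_def vec_eq_iff)
  moreover have "v + (-\<epsilon>) *\<^sub>R d \<noteq> v + \<epsilon> *\<^sub>R d" using d(1) \<epsilon>(1) by (simp add: vec_eq_iff)
  ultimately have "v \<in> open_segment (v + (-\<epsilon>) *\<^sub>R d) (v + \<epsilon> *\<^sub>R d)"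
    by (metis midpoint_in_open_segment)
  with v feas[of "-\<epsilon>"] feas[of \<epsilon>] \<epsilon>(1) show False
    unfolding extreme_point_of_def by auto
qed

lemma pinv_eq_if_inverse:
  fixes M :: "real^'m^'k"
  assumes XM: "X ** M = mat 1" and MX: "M ** X = mat 1"
  shows "pinv M = X"
  unfolding pinv_def
proof (rule the_equality)
  fix Y
  assume "M ** Y ** M = M \<and> Y ** M ** Y = Y \<and>
    transpose (M ** Y) = M ** Y \<and> transpose (Y ** M) = Y ** M"
  \<comment> \<open>The first Penrose equation alone forces uniqueness: the left side collapses to
    \<open>Y\<close>, the right side to \<open>X\<close>.\<close>
  then have "X ** (M ** Y ** M) ** X = X ** M ** X" by simp
  then show "Y = X"
    by (metis XM MX matrix_mul_assoc matrix_mul_lid matrix_mul_rid)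
qed (simp add: XM MX matrix_mul_assoc[symmetric] transpose_mat)

text \<open>The selected submatrix is invertible, so the null-space projector multiplying
  \<open>w\<close> vanishes and the correction of \<open>f\<close> lands on the unique solution of
  the selected equations, which is \<open>v\<close>.\<close>

lemma candidate_eq_solution:
  fixes A :: "real^'m^'c" and \<gamma> :: "'k::finite \<Rightarrow> 'c"
  assumes span: "span ((\<lambda>i. A $ i) ` range \<gamma>) = UNIV"
    and card: "CARD('k) = CARD('m)"
    and sol: "\<And>i. (A *v v) $ \<gamma> i = b $ \<gamma> i"
  shows "candidate A b f w \<gamma> = v"
proof -
  define M where "M = select A \<gamma>"
  have "rows M = (\<lambda>i. A $ i) ` range \<gamma>"
    by (auto simp: rows_def row_def M_def select_def vec_lambda_eta)
  then obtain X :: "real^'k^'m" where XM: "X ** M = mat 1"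
    using span by (metis matrix_left_invertible_span_rows)
  then have "inj ((*v) M)" by (metis matrix_left_invertible_injective)
  \<comment> \<open>The index types \<open>'k\<close> and \<open>'m\<close> may differ, so
    \<open>M\<close> is square only by cardinality; injectivity passes to surjectivity through the
    rank.\<close>
  then have "surj ((*v) M)"
    by (metis card full_rank_injective full_rank_surjective)
  then obtain Y where MY: "M ** Y = mat 1" by (metis matrix_right_invertible_surjective)
  then have "M ** X = mat 1"
    by (metis XM matrix_mul_assoc matrix_mul_lid matrix_mul_rid)
  with XM have pinv: "pinv M = X" by (rule pinv_eq_if_inverse)
  have bv: "select b \<gamma> = M *v v"
    using sol by (simp add: vec_eq_iff select_def M_def matrix_vector_mult_def)
  have "candidate A b f w \<gamma> = f - X *v (M *v f - M *v v)"
    by (simp add: candidate_def bv pinv XM flip: M_def)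
  also have "\<dots> = v"
    by (simp add: matrix_vector_mult_diff_distrib matrix_vector_mul_assoc XM)
  finally show ?thesis .
qed

text \<open>Listing \<open>J\<close> in increasing order gives the sequence. Its length fits because
  \<open>J\<close> consists of row indices, so \<open>CARD('m)\<close> is at most
  \<open>CARD('c)\<close> and is the minimum.\<close>

lemma obtains_strict_mono_min_index:
  fixes J :: "'c::{finite, linorder} set"
  assumes "card J = CARD('m::finite)"
  obtains \<gamma> :: "('c, 'm::finite) min_index \<Rightarrow> 'c" where "strict_mono \<gamma>" "range \<gamma> = J"
proof -
  have min: "min CARD('c) CARD('m) = card J"
    using assms card_mono[of UNIV J] by simp
  define h where "h = (!) (sorted_list_of_set J)"
  have h: "h ` {0..<card J} = J" "strict_mono_on {0..<card J} h"
    using sorted_wrt_nth_less[OF strict_sorted_list_of_set[of J]]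
      nth_image[of "card J" "sorted_list_of_set J"]
    by (auto simp: h_def strict_mono_on_def)
  define \<gamma> :: "('c, 'm) min_index \<Rightarrow> 'c" where "\<gamma> = h \<circ> Rep_min_index"
  have rep: "range (Rep_min_index :: ('c, 'm) min_index \<Rightarrow> nat) = {0..<card J}"
    by (simp add: type_definition.Rep_range[OF type_definition_min_index] min atLeast0LessThan)
  have "strict_mono \<gamma>"
    using h(2) rep unfolding \<gamma>_def strict_mono_on_def less_min_index_def comp_def by blast
  moreover have "range \<gamma> = J"
    by (metis \<gamma>_def h(1) image_comp rep)
  ultimately show ?thesis by (rule that)
qed

lemma feasible_candidates_nonempty:
  fixes A :: "real^'m^'c::{finite, linorder}"
  assumes "feasible A b \<noteq> {}" "polytope (feasible A b)"
  shows "feasible_candidates A b f w \<noteq> {}"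
proof -
  \<comment> \<open>A non-empty compact convex set has an extreme point; boundedness of the polytope
    enters here.\<close>
  obtain v where v: "v extreme_point_of feasible A b"
    using extreme_point_exists_convex assms polytope_imp_compact polytope_imp_convex by metis
  define I where "I = {i. (A *v v) $ i = b $ i}"
  have "span ((\<lambda>i. A $ i) ` I) = UNIV"
    using extreme_point_active_rows_span[OF v] by (simp add: I_def)
  then obtain B where B: "B \<subseteq> (\<lambda>i. A $ i) ` I" "independent B" "span B = UNIV"
    using maximal_independent_subset[of "(\<lambda>i. A $ i) ` I"]
    by (metis span_mono span_span subset_antisym top_greatest)
  \<comment> \<open>Different indices may carry the same row vector; \<open>J\<close> keeps one
    index per basis vector, so that \<open>J\<close> and \<open>B\<close> have equal size.\<close>
  then obtain J where J: "J \<subseteq> I" "inj_on (\<lambda>i. A $ i) J" "B = (\<lambda>i. A $ i) ` J"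
    by (metis subset_image_inj)
  have "card B = CARD('m)"
    using B(2,3) by (metis DIM_cart DIM_real dim_UNIV dim_span_eq_card_independent mult.right_neutral)
  then have "card J = CARD('m)" using J by (simp add: card_image)
  then obtain \<gamma> :: "('c, 'm) min_index \<Rightarrow> 'c" where \<gamma>: "strict_mono \<gamma>" "range \<gamma> = J"
    by (rule obtains_strict_mono_min_index)
  have "CARD(('c, 'm) min_index) = CARD('m)"
    using \<open>card J = CARD('m)\<close> card_mono[of UNIV J] by (simp add: card_min_index)
  then have "candidate A b f w \<gamma> = v"
    using B(3) J \<gamma>(2) by (intro candidate_eq_solution) (auto simp: I_def)
  then have "v \<in> candidates A b f w" using \<gamma>(1) by (auto simp: candidates_def)
  moreover have "A *v v \<le> b" using v by (simp add: extreme_point_of_def feasible_def)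
  ultimately show ?thesis by (auto simp: feasible_candidates_def)
qed

lemma finite_feasible_candidates: "finite (feasible_candidates A b f w)"
  by (simp add: feasible_candidates_def candidates_def)

theorem proposition1:
  fixes A :: "real^'n \<Rightarrow> real^'m^'c::{finite, linorder}"
    and b :: "real^'n \<Rightarrow> real^'c::{finite, linorder}"
    and f w :: "real^'n \<Rightarrow> real^'m"
    and p :: ereal
    and pick :: "real^'n \<Rightarrow> (real^'m) set \<Rightarrow> real^'m"
    and x :: "real^'n"
  assumes "continuous_on UNIV A"
    and "continuous_on UNIV b"
    and "\<And>x. feasible (A x) (b x) \<noteq> {} \<and> polytope (feasible (A x) (b x))"
    and "1 \<le> p"
    and "tie_breaking pick"
  shows "A x *v caffnet_lite p pick A b f w x \<le> b x"
proof (cases "f x \<in> feasible (A x) (b x)")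
  case True
  then show ?thesis by (simp add: caffnet_lite_def feasible_def)
next
  case False
  let ?S = "feasible_candidates (A x) (b x) (f x) (w x)"
  let ?T = "{y. is_arg_min (\<lambda>y. p_norm p (y - f x)) (\<lambda>y. y \<in> ?S) y}"
  have "?S \<noteq> {}" using assms(3) by (simp add: feasible_candidates_nonempty)
  \<comment> \<open>Over a finite non-empty set the distance attains its minimum, so
    \<open>pick\<close> is never applied to the empty set, where its value would be
    unspecified.\<close>
  then have "?T \<noteq> {}"
    using ex_is_arg_min_if_finite[OF finite_feasible_candidates] by fastforce
  then have "pick x ?T \<in> ?T" using assms(5) unfolding tie_breaking_def by blast
  then have "pick x ?T \<in> ?S" by (simp add: is_arg_min_def)
  then show ?thesis using False by (simp add: caffnet_lite_def feasible_candidates_def)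
qed

end
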